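(* Let $G=(V,E,\nu,\mu)$ be an infinite spherically symmetric weighted graph centered at $x_0\in V$, with associated subgroup $\Gamma$ of the automorphism group. In the quotient graph $G/\Gamma$ let $\underline{B}_r$ be the ball of radius $r$ centered at $[x_0]$ and $\underline{A}_{r,R}=\underline{B}_R\setminus\underline{B}_r$, with $r,R$ nonnegative integers. Then $$h(G)=\inf_{r\ge0}\frac{|\partial\underline{B}_r|}{|\underline{B}_r|},$$ $$h_\infty(G)=\liminf_{r\to\infty}\ \inf_{R\ge r+1}\frac{|\partial\underline{A}_{r,R}|}{|\underline{A}_{r,R}|}.$$ Moreover, if $G$ has infinite $\nu$-measure (i.e. $\sum_{x\in V}\nu_x=\infty$), then $$h_\infty(G)=\liminf_{r\to\infty}\frac{|\partial\underline{B}_r|}{|\underline{B}_r|}.$$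
   Context: A weighted graph $G=(V,E,\nu,\mu)$ consists of a locally finite, simple, undirected graph $(V,E)$, an edge weight $\mu:E\to(0,\infty)$, $\{x,y\}\mapsto\mu_{xy}=\mu_{yx}$, extended by $\mu_{xy}=0$ if $\{x,y\}\notin E$, and a vertex measure $\nu:V\to(0,\infty)$, $x\mapsto\nu_x$. $d$ is the combinatorial (shortest path) distance, $B_r(x)=\{y:d(y,x)\le r\}$, $S_r(x)=\{y:d(y,x)=r\}$. An automorphism of $G$ is a graph isomorphism $g:V\to V$ with $\mu_{g(x)g(y)}=\mu_{xy}$ and $\nu_{g(x)}=\nu_x$ for all $x,y$; they form the group $\mathrm{Aut}(G)$. $G$ is spherically symmetric centered at $x_0$ if for every integer $r\ge0$ and all $x,y\in S_r(x_0)$ there is an automorphism of $G$ fixing $x_0$ and mapping $x$ to $y$. An associated subgroup is a subgroup $\Gamma\le\mathrm{Aut}(G)$ fixing $x_0$ whose orbits on $V$ are exactly the (finite) spheres $\{S_r(x_0)\}_{r=0}^\infty$ (in particular $G$ is connected). The quotient graph $G/\Gamma$ is the weighted graph whose vertices are the $\Gamma$-orbits $[x]$; two different orbits $[x],[y]$ are adjacent if there are $x'\in[x]$, $y'\in[y]$ with $x'\sim y'$; edge weights $\mu_{[x][y]}=\sum_{x_1\in[x],y_1\in[y]}\mu_{x_1y_1}$ for $[x]\ne[y]$, vertex weights $\nu_{[x]}=\sum_{x_1\in[x]}\nu_{x_1}$, no self-loops. In any weighted graph, for a vertex set $U$, $\partial U$ is the set of edges with exactly one endpoint in $U$, $|\partial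 U|=|\partial U|_\mu$ is the sum of $\mu$ over $\partial U$, and $|U|=|U|_\nu$ is the sum of $\nu$ over $U$. For a finite nonempty $\Omega\subset V$, $h(\Omega)=\min_{\emptyset\neq U\subset\Omega}|\partial U|_\mu/|U|_\nu$. For infinite $G$ with an exhaustion $\{\Omega_i\}$ (finite sets, $\Omega_i\subset\Omega_{i+1}$, $\bigcup_i\Omega_i=V$), $$h(G)=\lim_{i\to\infty}h(\Omega_i),\qquad h_\infty(G)=\lim_{i\to\infty}\lim_{j\to\infty}h(\Omega_j\setminus\Omega_i)\in[0,\infty],$$ independently of the exhaustion. *)

theory Defs
  imports "HOL-Analysis.Analysis" "HOL-Algebra.Group_Action"
begin

section \<open>Weighted graphs\<close>

text \<open>An undirected edge \<open>{x, y}\<close> is represented by the two pairs \<open>(x, y)\<close> and \<open>(y, x)\<close>.\<close>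

record 'a wgraph =
  verts :: "'a set"
  edges :: "('a \<times> 'a) set"
  vweight :: "'a \<Rightarrow> real"
  eweight :: "'a \<Rightarrow> 'a \<Rightarrow> real"

locale weighted_graph =
  fixes G :: "'a wgraph"
  assumes edges_verts: "edges G \<subseteq> verts G \<times> verts G"
    and edges_sym: "sym (edges G)"
    and edges_irrefl: "irrefl (edges G)"
    and locally_finite: "x \<in> verts G \<Longrightarrow> finite {y. (x, y) \<in> edges G}"
    and vweight_pos: "x \<in> verts G \<Longrightarrow> vweight G x > 0"
    and eweight_sym: "\<lbrakk>x \<in> verts G; y \<in> verts G\<rbrakk> \<Longrightarrow> eweight G x y = eweight G y x"
    and eweight_pos: "(x, y) \<in> edges G \<Longrightarrow> eweight G x y > 0"
    and eweight_zero: "\<lbrakk>x \<in> verts G; y \<in> verts G; (x, y) \<notin> edges G\<rbrakk> \<Longrightarrow> eweight G x y = 0"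

text \<open>\<open>edges G ^^ n\<close> relates the endpoints of walks of length \<open>n\<close>; the distance between
  vertices in different components is \<open>\<infinity>\<close>, the infimum of the empty set.\<close>

definition gdist :: "'a wgraph \<Rightarrow> 'a \<Rightarrow> 'a \<Rightarrow> enat" where
  "gdist G x y = Inf {enat n | n. (x, y) \<in> edges G ^^ n}"

definition gball :: "'a wgraph \<Rightarrow> 'a \<Rightarrow> nat \<Rightarrow> 'a set" where
  "gball G x r = {y \<in> verts G. gdist G y x \<le> enat r}"

definition gsphere :: "'a wgraph \<Rightarrow> 'a \<Rightarrow> nat \<Rightarrow> 'a set" where
  "gsphere G x r = {y \<in> verts G. gdist G y x = enat r}"

section \<open>Automorphisms and spherical symmetry\<close>

text \<open>As in \<^const>\<open>Bij\<close>, automorphisms are extensional functions on the vertex set.\<close>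

definition wgraph_auto :: "'a wgraph \<Rightarrow> ('a \<Rightarrow> 'a) set" where
  "wgraph_auto G = {g \<in> Bij (verts G).
     (\<forall>x\<in>verts G. \<forall>y\<in>verts G. (g x, g y) \<in> edges G \<longleftrightarrow> (x, y) \<in> edges G) \<and>
     (\<forall>x\<in>verts G. \<forall>y\<in>verts G. eweight G (g x) (g y) = eweight G x y) \<and>
     (\<forall>x\<in>verts G. vweight G (g x) = vweight G x)}"

definition wgraph_AutoGroup :: "'a wgraph \<Rightarrow> ('a \<Rightarrow> 'a) monoid" where
  "wgraph_AutoGroup G = BijGroup (verts G) \<lparr>carrier := wgraph_auto G\<rparr>"

definition spherically_symmetric :: "'a wgraph \<Rightarrow> 'a \<Rightarrow> bool" where
  "spherically_symmetric G x\<^sub>0 \<longleftrightarrow> x\<^sub>0 \<in> verts G \<and>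
     (\<forall>r. \<forall>x\<in>gsphere G x\<^sub>0 r. \<forall>y\<in>gsphere G x\<^sub>0 r.
        \<exists>g\<in>wgraph_auto G. g x\<^sub>0 = x\<^sub>0 \<and> g x = y)"

definition vertex_orbit :: "'a wgraph \<Rightarrow> ('a \<Rightarrow> 'a) set \<Rightarrow> 'a \<Rightarrow> 'a set" where
  "vertex_orbit G \<Gamma> = orbit (wgraph_AutoGroup G \<lparr>carrier := \<Gamma>\<rparr>) (\<lambda>g. g)"

definition vertex_orbits :: "'a wgraph \<Rightarrow> ('a \<Rightarrow> 'a) set \<Rightarrow> 'a set set" where
  "vertex_orbits G \<Gamma> = orbits (wgraph_AutoGroup G \<lparr>carrier := \<Gamma>\<rparr>) (verts G) (\<lambda>g. g)"

definition associated_subgroup :: "'a wgraph \<Rightarrow> 'a \<Rightarrow> ('a \<Rightarrow> 'a) set \<Rightarrow> bool" where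
  "associated_subgroup G x\<^sub>0 \<Gamma> \<longleftrightarrow>
     subgroup \<Gamma> (wgraph_AutoGroup G) \<and> (\<forall>g\<in>\<Gamma>. g x\<^sub>0 = x\<^sub>0) \<and>
     (\<forall>r. finite (gsphere G x\<^sub>0 r)) \<and>
     vertex_orbits G \<Gamma> = range (gsphere G x\<^sub>0)"

definition quotient_graph :: "'a wgraph \<Rightarrow> ('a \<Rightarrow> 'a) set \<Rightarrow> 'a set wgraph" where
  "quotient_graph G \<Gamma> =
     \<lparr>verts = vertex_orbits G \<Gamma>,
      edges = {(X, Y). X \<in> vertex_orbits G \<Gamma> \<and> Y \<in> vertex_orbits G \<Gamma> \<and> X \<noteq> Y \<and>
                       (\<exists>x\<in>X. \<exists>y\<in>Y. (x, y) \<in> edges G)},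
      vweight = (\<lambda>X. \<Sum>x\<in>X. vweight G x),
      eweight = (\<lambda>X Y. if X = Y then 0 else \<Sum>x\<in>X. \<Sum>y\<in>Y. eweight G x y)\<rparr>"

section \<open>Cheeger constants\<close>

text \<open>Each edge of the boundary is recorded once, as the pair whose first component is its
  endpoint in \<open>U\<close>.\<close>

definition edge_boundary :: "'a wgraph \<Rightarrow> 'a set \<Rightarrow> ('a \<times> 'a) set" where
  "edge_boundary G U = {(x, y) \<in> edges G. x \<in> U \<and> y \<notin> U}"

definition boundary_weight :: "'a wgraph \<Rightarrow> 'a set \<Rightarrow> real" where
  "boundary_weight G U = (\<Sum>(x, y)\<in>edge_boundary G U. eweight G x y)"

definition vertex_weight :: "'a wgraph \<Rightarrow> 'a set \<Rightarrow> real" where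
  "vertex_weight G U = (\<Sum>x\<in>U. vweight G x)"

definition boundary_ratio :: "'a wgraph \<Rightarrow> 'a set \<Rightarrow> real" where
  "boundary_ratio G U = boundary_weight G U / vertex_weight G U"

text \<open>Only meaningful for finite nonempty \<open>\<Omega>\<close>.\<close>

definition cheeger_set :: "'a wgraph \<Rightarrow> 'a set \<Rightarrow> real" where
  "cheeger_set G \<Omega> = Min {boundary_ratio G U | U. U \<subseteq> \<Omega> \<and> U \<noteq> {}}"

definition exhaustion :: "'a wgraph \<Rightarrow> (nat \<Rightarrow> 'a set) \<Rightarrow> bool" where
  "exhaustion G \<Omega> \<longleftrightarrow>
     (\<forall>i. finite (\<Omega> i)) \<and> (\<forall>i. \<Omega> i \<subseteq> \<Omega> (Suc i)) \<and> (\<Union>i. \<Omega> i) = verts G"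

text \<open>The constants of the graph are the common limits along all exhaustions. Finitely many
  terms of these limits may involve \<^const>\<open>cheeger_set\<close> of the empty set, which does not affect
  them when the vertex set is infinite.\<close>

definition cheeger :: "'a wgraph \<Rightarrow> ereal" where
  "cheeger G = (THE h. \<forall>\<Omega>. exhaustion G \<Omega> \<longrightarrow>
     (\<lambda>i. ereal (cheeger_set G (\<Omega> i))) \<longlonglongrightarrow> h)"

definition cheeger_infinity :: "'a wgraph \<Rightarrow> ereal" where
  "cheeger_infinity G = (THE h. \<forall>\<Omega>. exhaustion G \<Omega> \<longrightarrow>
     (\<exists>l. (\<forall>i. (\<lambda>j. ereal (cheeger_set G (\<Omega> j - \<Omega> i))) \<longlonglongrightarrow> l i) \<and> l \<longlonglongrightarrow> h))"

end

theory Submission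
  imports Defs
begin

text \<open>By spherical symmetry the isoperimetric problem is one-dimensional.  Replace a finite vertex
  set \<open>U\<close> by the function \<open>\<phi>\<close> on the nonnegative integers whose value at \<open>r\<close> is the fraction
  of the sphere of radius \<open>r\<close> that \<open>U\<close> occupies.  This keeps the vertex weight,
  \<open>|U| = (\<Sum>r. m r * \<phi> r)\<close> with \<open>m r\<close> the weight of the sphere, and does not increase the
  boundary, \<open>(\<Sum>r. b r * \<bar>\<phi> r - \<phi> (Suc r)\<bar>) \<le> |\<partial>U|\<close> with \<open>b r\<close> the total weight of the edges
  between the spheres of radius \<open>r\<close> and \<open>r + 1\<close>
  (\<open>boundary_weight_ge_sphere_fraction\<close>), because every vertex of a sphere has the same weighted
  degree into each neighbouring sphere.

  On the half-line the inequality \<open>c * (\<Sum>r. m r * \<phi> r) \<le> (\<Sum>r. b r * \<bar>\<phi> r - \<phi> (Suc r)\<bar>)\<close> is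
  certified by duality: with \<open>M r\<close> the weight of the ball of radius \<open>r\<close>, it follows by summation by
  parts as soon as \<open>\<bar>c * M r - K\<bar> \<le> b r\<close> for some constant \<open>K\<close> and all relevant \<open>r\<close>
  (\<open>flow_isoperimetric\<close>).  For arbitrary \<open>U\<close> take \<open>K = 0\<close>; the condition then says exactly that
  all balls have ratio at least \<open>c\<close>.  If \<open>U\<close> avoids the ball of radius \<open>a\<close>, then \<open>K\<close> is free, and
  a suitable \<open>K\<close> exists as soon as all annuli of inner radius at least \<open>a\<close> have ratio at least \<open>c\<close>
  (\<open>flow_offset_exists\<close>).  Hence balls, respectively annuli, are optimal.

  The two Cheeger constants are the infimum of the ratio over all finite nonempty sets, and the
  supremum over \<open>a\<close> of its infimum over those that avoid the ball of radius \<open>a\<close>, so the first two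
  formulas follow.  When the total weight is infinite, the inner boundary and the inner ball
  of an annulus become negligible as its outer radius grows (\<open>liminf_segment_ratio_eq\<close>), which
  turns the annuli into balls.  Finally, the quotient graph is the half-line with vertex weights \<open>m\<close>
  and edge weights \<open>b\<close>, so its balls and annuli have the same ratios as those of the graph.\<close>

section \<open>Cheeger constants as infima over finite sets\<close>

text \<open>The Cheeger constant of the complement of \<open>W\<close>.  Both \<^const>\<open>cheeger\<close> and
  \<^const>\<open>cheeger_infinity\<close> are expressed through it, which removes the exhaustions.\<close>

definition outer_cheeger :: "'a wgraph \<Rightarrow> 'a set \<Rightarrow> ereal" where
  "outer_cheeger G W =
     (INF U\<in>{U. finite U \<and> U \<noteq> {} \<and> U \<subseteq> verts G - W}. ereal (boundary_ratio G U))"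

lemma outer_cheeger_lower:
  "\<lbrakk>finite U; U \<noteq> {}; U \<subseteq> verts G - W\<rbrakk> \<Longrightarrow> outer_cheeger G W \<le> ereal (boundary_ratio G U)"
  unfolding outer_cheeger_def by (rule INF_lower) simp

lemma outer_cheeger_mono: "W \<subseteq> W' \<Longrightarrow> outer_cheeger G W \<le> outer_cheeger G W'"
  unfolding outer_cheeger_def by (rule INF_superset_mono) auto

lemma cheeger_set_le:
  assumes "finite \<Omega>" "U \<subseteq> \<Omega>" "U \<noteq> {}"
  shows "cheeger_set G \<Omega> \<le> boundary_ratio G U"
  unfolding cheeger_set_def using assms by (intro Min_le) auto

lemma cheeger_set_attained:
  assumes "finite \<Omega>" "\<Omega> \<noteq> {}"
  obtains U where "U \<subseteq> \<Omega>" "U \<noteq> {}" "cheeger_set G \<Omega> = boundary_ratio G U"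
proof -
  let ?R = "{boundary_ratio G U |U. U \<subseteq> \<Omega> \<and> U \<noteq> {}}"
  have "Min ?R \<in> ?R" using assms by (intro Min_in) auto
  then show ?thesis using that unfolding cheeger_set_def by auto
qed

lemma exhaustion_mono: "exhaustion G \<Omega> \<Longrightarrow> i \<le> j \<Longrightarrow> \<Omega> i \<subseteq> \<Omega> j"
  unfolding exhaustion_def by (metis lift_Suc_mono_le)

lemma exhaustion_covers_finite:
  assumes ex: "exhaustion G \<Omega>" and "finite U" "U \<subseteq> verts G"
  shows "eventually (\<lambda>i. U \<subseteq> \<Omega> i) sequentially"
proof -
  have "eventually (\<lambda>i. x \<in> \<Omega> i) sequentially" if "x \<in> U" for x
  proof -
    have "x \<in> (\<Union>i. \<Omega> i)" using assms that unfolding exhaustion_def by auto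
    then obtain k where "x \<in> \<Omega> k" by blast
    then have "x \<in> \<Omega> i" if "i \<ge> k" for i using exhaustion_mono[OF ex that] by blast
    then show ?thesis unfolding eventually_sequentially by blast
  qed
  then have "eventually (\<lambda>i. \<forall>x\<in>U. x \<in> \<Omega> i) sequentially"
    using \<open>finite U\<close> by (simp add: eventually_ball_finite)
  then show ?thesis by (simp add: subset_iff Ball_def)
qed

text \<open>Every competitor in the infimum is finite, so it is eventually swallowed by the exhaustion.
  Infinitely many vertices make the sets \<open>\<Omega> j - W\<close> eventually nonempty, so that the minimum in
  \<^const>\<open>cheeger_set\<close> is attained.\<close>

lemma cheeger_set_tendsto_outer_cheeger:
  assumes inf: "infinite (verts G)" and ex: "exhaustion G \<Omega>" and W: "finite W"
  shows "(\<lambda>j. ereal (cheeger_set G (\<Omega> j - W))) \<longlonglongrightarrow> outer_cheeger G W"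
proof (rule order_tendstoI)
  have fin: "finite (\<Omega> j)" and sub: "\<Omega> j \<subseteq> verts G" for j
    using ex unfolding exhaustion_def by auto
  fix a
  { assume a: "a < outer_cheeger G W"
    have "infinite (verts G - W)" using inf W by simp
    then obtain x where x: "x \<in> verts G - W"
      by (metis finite.emptyI ex_in_conv)
    have "eventually (\<lambda>j. {x} \<subseteq> \<Omega> j) sequentially"
      using exhaustion_covers_finite[OF ex, of "{x}"] x by simp
    then show "eventually (\<lambda>j. a < ereal (cheeger_set G (\<Omega> j - W))) sequentially"
    proof (rule eventually_mono)
      fix j assume "{x} \<subseteq> \<Omega> j"
      then have "\<Omega> j - W \<noteq> {}" using x by auto
      with fin obtain U where U: "U \<subseteq> \<Omega> j - W" "U \<noteq> {}"
        "cheeger_set G (\<Omega> j - W) = boundary_ratio G U"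
        by (metis cheeger_set_attained finite_Diff)
      then have "outer_cheeger G W \<le> ereal (boundary_ratio G U)"
        using sub fin by (intro outer_cheeger_lower) (auto intro: finite_subset)
      then show "a < ereal (cheeger_set G (\<Omega> j - W))" using a U(3) by simp
    qed }
  { assume "a > outer_cheeger G W"
    then obtain U where U: "finite U" "U \<noteq> {}" "U \<subseteq> verts G - W" "ereal (boundary_ratio G U) < a"
      unfolding outer_cheeger_def INF_less_iff by auto
    have "eventually (\<lambda>j. U \<subseteq> \<Omega> j) sequentially"
      using exhaustion_covers_finite[OF ex] U by blast
    then show "eventually (\<lambda>j. ereal (cheeger_set G (\<Omega> j - W)) < a) sequentially"
    proof (rule eventually_mono)
      fix j assume "U \<subseteq> \<Omega> j"
      then have "cheeger_set G (\<Omega> j - W) \<le> boundary_ratio G U"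
        using fin U by (intro cheeger_set_le) auto
      then show "ereal (cheeger_set G (\<Omega> j - W)) < a"
        using U(4) by (meson ereal_less_eq(3) le_less_trans)
    qed }
qed

lemma cheeger_eq_outer_cheeger:
  assumes inf: "infinite (verts G)" and ex: "exhaustion G \<Omega>"
  shows "cheeger G = outer_cheeger G {}"
  unfolding cheeger_def
proof (rule the_equality)
  have lim: "(\<lambda>i. ereal (cheeger_set G (\<Omega>' i))) \<longlonglongrightarrow> outer_cheeger G {}"
    if "exhaustion G \<Omega>'" for \<Omega>'
    using cheeger_set_tendsto_outer_cheeger[OF inf that, of "{}"] by simp
  then show "\<forall>\<Omega>. exhaustion G \<Omega> \<longrightarrow>
      (\<lambda>i. ereal (cheeger_set G (\<Omega> i))) \<longlonglongrightarrow> outer_cheeger G {}" by blast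
  show "h = outer_cheeger G {}"
    if "\<forall>\<Omega>. exhaustion G \<Omega> \<longrightarrow> (\<lambda>i. ereal (cheeger_set G (\<Omega> i))) \<longlonglongrightarrow> h" for h
    using that ex lim LIMSEQ_unique by blast
qed

text \<open>The limit is written as a supremum over all finite sets because that does not mention the
  exhaustion: this gives the independence on which \<^const>\<open>cheeger_infinity\<close> relies.\<close>

lemma outer_cheeger_tendsto:
  assumes ex: "exhaustion G \<Omega>"
  shows "(\<lambda>i. outer_cheeger G (\<Omega> i)) \<longlonglongrightarrow> (SUP W\<in>{W. finite W \<and> W \<subseteq> verts G}. outer_cheeger G W)"
    (is "_ \<longlonglongrightarrow> ?s")
proof -
  have "incseq (\<lambda>i. outer_cheeger G (\<Omega> i))"
    by (intro monoI outer_cheeger_mono exhaustion_mono[OF ex])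
  then have "(\<lambda>i. outer_cheeger G (\<Omega> i)) \<longlonglongrightarrow> (SUP i. outer_cheeger G (\<Omega> i))"
    by (rule LIMSEQ_SUP)
  moreover have "(SUP i. outer_cheeger G (\<Omega> i)) = ?s"
  proof (rule antisym)
    show "(SUP i. outer_cheeger G (\<Omega> i)) \<le> ?s"
      using ex by (intro SUP_least SUP_upper) (auto simp: exhaustion_def)
    show "?s \<le> (SUP i. outer_cheeger G (\<Omega> i))"
    proof (rule SUP_least)
      fix W assume "W \<in> {W. finite W \<and> W \<subseteq> verts G}"
      then obtain i where "W \<subseteq> \<Omega> i"
        using exhaustion_covers_finite[OF ex, of W] by (auto simp: eventually_sequentially)
      then show "outer_cheeger G W \<le> (SUP i. outer_cheeger G (\<Omega> i))"
        by (intro SUP_upper2[of i] outer_cheeger_mono) auto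
    qed
  qed
  ultimately show ?thesis by simp
qed

lemma cheeger_infinity_eq_SUP_outer_cheeger:
  assumes inf: "infinite (verts G)" and ex: "exhaustion G \<Omega>"
  shows "cheeger_infinity G = (SUP i. outer_cheeger G (\<Omega> i))"
proof -
  define s where "s = (SUP W\<in>{W. finite W \<and> W \<subseteq> verts G}. outer_cheeger G W)"
  have inner: "(\<lambda>j. ereal (cheeger_set G (\<Omega>' j - \<Omega>' i))) \<longlonglongrightarrow> outer_cheeger G (\<Omega>' i)"
    if "exhaustion G \<Omega>'" for \<Omega>' i
    using that by (intro cheeger_set_tendsto_outer_cheeger inf) (auto simp: exhaustion_def)
  have outer: "(\<lambda>i. outer_cheeger G (\<Omega>' i)) \<longlonglongrightarrow> s" if "exhaustion G \<Omega>'" for \<Omega>'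
    unfolding s_def by (rule outer_cheeger_tendsto[OF that])
  have "cheeger_infinity G = s"
    unfolding cheeger_infinity_def
  proof (rule the_equality)
    show "\<forall>\<Omega>. exhaustion G \<Omega> \<longrightarrow> (\<exists>l. (\<forall>i. (\<lambda>j. ereal (cheeger_set G (\<Omega> j - \<Omega> i))) \<longlonglongrightarrow> l i) \<and> l \<longlonglongrightarrow> s)"
    proof (intro allI impI exI conjI)
      fix \<Omega>' :: "nat \<Rightarrow> 'a set" and i assume "exhaustion G \<Omega>'"
      then show "(\<lambda>j. ereal (cheeger_set G (\<Omega>' j - \<Omega>' i))) \<longlonglongrightarrow> outer_cheeger G (\<Omega>' i)"
        "(\<lambda>i. outer_cheeger G (\<Omega>' i)) \<longlonglongrightarrow> s"
        by (rule inner, rule outer)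
    qed
    fix h
    assume "\<forall>\<Omega>. exhaustion G \<Omega> \<longrightarrow> (\<exists>l. (\<forall>i. (\<lambda>j. ereal (cheeger_set G (\<Omega> j - \<Omega> i))) \<longlonglongrightarrow> l i) \<and> l \<longlonglongrightarrow> h)"
    then obtain l where l: "\<And>i. (\<lambda>j. ereal (cheeger_set G (\<Omega> j - \<Omega> i))) \<longlonglongrightarrow> l i" "l \<longlonglongrightarrow> h"
      using ex by blast
    have "l = (\<lambda>i. outer_cheeger G (\<Omega> i))"
      using LIMSEQ_unique[OF l(1) inner[OF ex]] by blast
    with l(2) show "h = s" using LIMSEQ_unique[OF _ outer[OF ex]] by simp
  qed
  moreover have "incseq (\<lambda>i. outer_cheeger G (\<Omega> i))"
    by (intro monoI outer_cheeger_mono exhaustion_mono[OF ex])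
  ultimately show ?thesis using LIMSEQ_unique[OF outer[OF ex] LIMSEQ_SUP] by simp
qed

section \<open>Weighted half-lines\<close>

lemma sum_by_parts_from_0:
  fixes m \<phi> :: "nat \<Rightarrow> real"
  shows "(\<Sum>r\<le>N. m r * \<phi> r) = (\<Sum>r\<le>N. (\<Sum>i\<le>r. m i) * (\<phi> r - \<phi> (Suc r))) + (\<Sum>i\<le>N. m i) * \<phi> (Suc N)"
  by (induction N) (auto simp: algebra_simps)

text \<open>Read \<open>c * (\<Sum>i\<le>r. m i) - K\<close> as a flow from \<open>r\<close> to \<open>r + 1\<close> along the half-line, with
  divergence \<open>c * m r\<close> at every vertex \<open>r > 0\<close>.  If it respects the capacities \<open>b\<close> wherever \<open>\<phi>\<close> jumps,
  it certifies the isoperimetric inequality with constant \<open>c\<close>, by summation by parts.  The constant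
  \<open>K\<close> is multiplied by the total jump \<open>\<phi> 0\<close> of \<open>\<phi>\<close>, so it is free when \<open>\<phi> 0 = 0\<close> and has to
  vanish otherwise.\<close>

lemma flow_isoperimetric:
  fixes m b \<phi> :: "nat \<Rightarrow> real"
  assumes end0: "\<phi> (Suc N) = 0" and origin: "K * \<phi> 0 = 0"
    and cap: "\<And>r. r \<le> N \<Longrightarrow> \<phi> r \<noteq> \<phi> (Suc r) \<Longrightarrow> \<bar>c * (\<Sum>i\<le>r. m i) - K\<bar> \<le> b r"
  shows "c * (\<Sum>r\<le>N. m r * \<phi> r) \<le> (\<Sum>r\<le>N. b r * \<bar>\<phi> r - \<phi> (Suc r)\<bar>)"
proof -
  have "K * (\<Sum>r\<le>N. \<phi> r - \<phi> (Suc r)) = 0"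
    using end0 origin by (simp only: sum_telescope) simp
  then have "c * (\<Sum>r\<le>N. m r * \<phi> r) = (\<Sum>r\<le>N. (c * (\<Sum>i\<le>r. m i) - K) * (\<phi> r - \<phi> (Suc r)))"
    unfolding sum_by_parts_from_0[of m \<phi> N]
    by (simp add: end0 left_diff_distrib sum_subtractf sum_distrib_left[symmetric] mult.assoc
        del: mult_eq_0_iff)
  also have "\<dots> \<le> (\<Sum>r\<le>N. b r * \<bar>\<phi> r - \<phi> (Suc r)\<bar>)"
  proof (rule sum_mono)
    fix r assume "r \<in> {..N}"
    then have "\<phi> r \<noteq> \<phi> (Suc r) \<Longrightarrow> \<bar>c * (\<Sum>i\<le>r. m i) - K\<bar> \<le> b r" using cap by simp
    then have "\<bar>c * (\<Sum>i\<le>r. m i) - K\<bar> * \<bar>\<phi> r - \<phi> (Suc r)\<bar> \<le> b r * \<bar>\<phi> r - \<phi> (Suc r)\<bar>"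
      by (cases "\<phi> r = \<phi> (Suc r)") (auto intro: mult_right_mono)
    moreover have "(c * (\<Sum>i\<le>r. m i) - K) * (\<phi> r - \<phi> (Suc r)) \<le> \<bar>c * (\<Sum>i\<le>r. m i) - K\<bar> * \<bar>\<phi> r - \<phi> (Suc r)\<bar>"
      by (metis abs_ge_self abs_mult)
    ultimately show "(c * (\<Sum>i\<le>r. m i) - K) * (\<phi> r - \<phi> (Suc r)) \<le> b r * \<bar>\<phi> r - \<phi> (Suc r)\<bar>"
      by linarith
  qed
  finally show ?thesis .
qed

text \<open>The intervals \<open>c * M r - b r \<le> K \<le> c * M r + b r\<close> meet pairwise, by the isoperimetric
  inequality for segments and the monotonicity of \<open>M\<close>; hence (Helly on the line) they have a common point.\<close>

lemma flow_offset_exists: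
  fixes M b :: "nat \<Rightarrow> real"
  assumes "a \<le> N" and c: "c \<ge> 0" and b: "\<And>r. b r \<ge> 0" and M: "mono M"
    and seg: "\<And>p q. a \<le> p \<Longrightarrow> p < q \<Longrightarrow> c * (M q - M p) \<le> b p + b q"
  shows "\<exists>K. \<forall>r\<in>{a..N}. \<bar>c * M r - K\<bar> \<le> b r"
proof (intro exI ballI)
  let ?K = "Max ((\<lambda>q. c * M q - b q) ` {a..N})"
  fix r assume r: "r \<in> {a..N}"
  have "c * M r - b r \<le> ?K" using r by (intro Max_ge) auto
  moreover have "?K \<le> c * M r + b r"
  proof (rule Max.boundedI)
    fix t assume "t \<in> (\<lambda>q. c * M q - b q) ` {a..N}"
    then obtain q where q: "a \<le> q" "t = c * M q - b q" by auto
    show "t \<le> c * M r + b r"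
    proof (cases "r < q")
      case True
      then show ?thesis using seg[of r q] r q by (simp add: algebra_simps)
    next
      case False
      then have "c * M q \<le> c * M r" using M c by (intro mult_left_mono) (auto simp: mono_def)
      then show ?thesis using b[of q] b[of r] q by linarith
    qed
  qed (use r in auto)
  ultimately show "\<bar>c * M r - ?K\<bar> \<le> b r" by linarith
qed

text \<open>Dropping the inner boundary \<open>b p\<close> and adding back the mass \<open>M p\<close> can only decrease the
  ratio, and for fixed \<open>p\<close> both changes are negligible along large \<open>q\<close> because
  \<open>M q\<close> tends to infinity.\<close>

lemma liminf_segment_ratio_eq:
  fixes M b :: "nat \<Rightarrow> real"
  assumes b: "\<And>r. b r \<ge> 0" and Mpos: "\<And>r. M r > 0" and M: "strict_mono M"
    and Minf: "filterlim M at_top sequentially"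
  shows "liminf (\<lambda>p. INF q\<in>{p + 1..}. ereal ((b p + b q) / (M q - M p))) =
    liminf (\<lambda>r. ereal (b r / M r))" (is "liminf ?g = ?L")
proof (rule antisym)
  have "(INF n\<in>{r..}. ereal (b n / M n)) \<le> ?g p" if "r \<le> p" for r p
  proof (rule INF_greatest)
    fix q assume q: "q \<in> {p + 1..}"
    then have "M p < M q" using M by (simp add: strict_mono_def)
    then have "b q / M q \<le> (b p + b q) / (M q - M p)"
      using b[of p] b[of q] Mpos[of p] by (intro frac_le) auto
    then show "(INF n\<in>{r..}. ereal (b n / M n)) \<le> ereal ((b p + b q) / (M q - M p))"
      using q that by (intro INF_lower2[of q]) auto
  qed
  then show "?L \<le> liminf ?g"
    unfolding liminf_SUP_INF by (intro SUP_mono) (auto intro: INF_greatest)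
  have "?g p \<le> ?L" for p
  proof (rule ccontr)
    assume "\<not> ?g p \<le> ?L"
    \<comment> \<open>The gap between \<open>t'\<close> and \<open>t\<close> absorbs the terms in \<open>p\<close> once \<open>M q\<close> is large.\<close>
    then obtain t where t: "?L < ereal t" "ereal t < ?g p"
      using ereal_dense2[of ?L "?g p"] unfolding not_le by blast
    then obtain t' where t': "?L < ereal t'" "t' < t"
      using ereal_dense2[OF t(1)] unfolding less_ereal.simps by blast
    have freq: "frequently (\<lambda>q. b q / M q < t') sequentially"
      unfolding frequently_def
    proof
      assume "eventually (\<lambda>q. \<not> b q / M q < t') sequentially"
      then have "ereal t' \<le> ?L" by (intro Liminf_bounded) (simp add: not_less)
      then show False using t'(1) by simp
    qed
    have "filterlim (\<lambda>q. (t - t') * M q) at_top sequentially"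
      using Minf t'(2) by (intro filterlim_tendsto_pos_mult_at_top[OF tendsto_const]) auto
    then have "eventually (\<lambda>q. (t - t') * M q > b p + t * M p) sequentially"
      unfolding filterlim_at_top_dense by blast
    then have "eventually (\<lambda>q. q > p \<and> (t - t') * M q > b p + t * M p) sequentially"
      by (intro eventually_conj eventually_gt_at_top)
    then obtain q where q: "q > p" "(t - t') * M q > b p + t * M p" "b q / M q < t'"
      using frequently_ex[OF frequently_eventually_frequently[OF freq]] by blast
    then have "M p < M q" using M by (simp add: strict_mono_def)
    moreover have "b q < t' * M q" using q(3) Mpos[of q] by (simp add: field_simps)
    ultimately have "(b p + b q) / (M q - M p) < t"
      using q(2) by (simp add: field_simps)
    moreover have "?g p \<le> ereal ((b p + b q) / (M q - M p))"
      using q(1) by (intro INF_lower) auto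
    ultimately show False using t(2)
      by (meson ereal_less_eq(3) less_imp_le not_le order_trans)
  qed
  then show "liminf ?g \<le> ?L"
    unfolding liminf_SUP_INF[of ?g] by (intro SUP_least) (meson INF_lower2 atLeast_iff order_refl)
qed

section \<open>Spheres of a spherically symmetric graph\<close>

lemma gdist_eq_enat_iff:
  "gdist G x y = enat r \<longleftrightarrow> (x, y) \<in> edges G ^^ r \<and> (\<forall>n. (x, y) \<in> edges G ^^ n \<longrightarrow> r \<le> n)"
  (is "_ \<longleftrightarrow> ?walk")
proof
  let ?D = "{enat n |n. (x, y) \<in> edges G ^^ n}"
  assume d: "gdist G x y = enat r"
  then have "?D \<noteq> {}" unfolding gdist_def by (metis Inf_empty enat.distinct(1) top_enat_def)
  then have "Inf ?D \<in> ?D" by (meson wellorder_InfI ex_in_conv)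
  moreover have "r \<le> n" if "(x, y) \<in> edges G ^^ n" for n
    using Inf_lower[of "enat n" ?D] that d unfolding gdist_def by auto
  ultimately show ?walk using d unfolding gdist_def by auto
next
  assume ?walk
  then show "gdist G x y = enat r"
    unfolding gdist_def by (intro antisym Inf_lower Inf_greatest) auto
qed

context weighted_graph
begin

lemma finite_edge_boundary: "\<lbrakk>finite U; U \<subseteq> verts G\<rbrakk> \<Longrightarrow> finite (edge_boundary G U)"
  by (rule finite_subset[of _ "Sigma U (\<lambda>x. {y. (x, y) \<in> edges G})"])
    (auto simp: edge_boundary_def intro!: locally_finite)

lemma eweight_nonneg: "\<lbrakk>x \<in> verts G; y \<in> verts G\<rbrakk> \<Longrightarrow> 0 \<le> eweight G x y"
  using eweight_pos[of x y] eweight_zero[of x y] by fastforce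

lemma vertex_weight_pos: "\<lbrakk>finite U; U \<noteq> {}; U \<subseteq> verts G\<rbrakk> \<Longrightarrow> 0 < vertex_weight G U"
  unfolding vertex_weight_def using vweight_pos by (intro sum_pos) auto

lemma sum_edges_between:
  assumes "finite X" "finite Y" "X \<subseteq> verts G" "Y \<subseteq> verts G"
  shows "(\<Sum>(x, y)\<in>edges G \<inter> X \<times> Y. eweight G x y) = (\<Sum>x\<in>X. \<Sum>y\<in>Y. eweight G x y)"
proof -
  have "(\<Sum>x\<in>X. \<Sum>y\<in>Y. eweight G x y) = (\<Sum>(x, y)\<in>X \<times> Y. eweight G x y)"
    using assms by (simp add: sum.cartesian_product)
  also have "\<dots> = (\<Sum>(x, y)\<in>edges G \<inter> X \<times> Y. eweight G x y)"
    using assms eweight_zero by (intro sum.mono_neutral_right) auto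
  finally show ?thesis ..
qed

lemma sum_between_sym:
  assumes "X \<subseteq> verts G" "Y \<subseteq> verts G"
  shows "(\<Sum>x\<in>X. \<Sum>y\<in>Y. eweight G x y) = (\<Sum>y\<in>Y. \<Sum>x\<in>X. eweight G y x)"
  using assms eweight_sym by (subst sum.swap) (intro sum.cong refl, auto)

lemma auto_relpow:
  assumes g: "g \<in> wgraph_auto G" and "x \<in> verts G" "y \<in> verts G"
  shows "(g x, g y) \<in> edges G ^^ n \<longleftrightarrow> (x, y) \<in> edges G ^^ n"
  using \<open>y \<in> verts G\<close>
proof (induction n arbitrary: y)
  case 0
  have "inj_on g (verts G)" using g by (auto simp: wgraph_auto_def Bij_def bij_betw_def)
  then show ?case using assms(2) 0 by (auto simp: inj_on_eq_iff)
next
  case (Suc n)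
  have surj: "g ` verts G = verts G" using g by (auto simp: wgraph_auto_def Bij_def bij_betw_def)
  have step: "(g z, g y) \<in> edges G \<longleftrightarrow> (z, y) \<in> edges G" if "z \<in> verts G" for z
    using g that Suc.prems by (auto simp: wgraph_auto_def)
  have "(g x, g y) \<in> edges G ^^ Suc n \<longleftrightarrow> (\<exists>z'\<in>g ` verts G. (g x, z') \<in> edges G ^^ n \<and> (z', g y) \<in> edges G)"
    using edges_verts surj by auto
  also have "\<dots> \<longleftrightarrow> (\<exists>z\<in>verts G. (x, z) \<in> edges G ^^ n \<and> (z, y) \<in> edges G)"
    using Suc.IH step by auto
  also have "\<dots> \<longleftrightarrow> (x, y) \<in> edges G ^^ Suc n"
    using edges_verts by auto
  finally show ?case .
qed

lemma auto_gdist: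
  "\<lbrakk>g \<in> wgraph_auto G; x \<in> verts G; y \<in> verts G\<rbrakk> \<Longrightarrow> gdist G (g x) (g y) = gdist G x y"
  unfolding gdist_def using auto_relpow by simp

end

locale symmetric_graph = weighted_graph G for G :: "'a wgraph" +
  fixes x\<^sub>0 :: 'a and \<Gamma> :: "('a \<Rightarrow> 'a) set"
  assumes infinite_verts: "infinite (verts G)"
    and symmetric: "spherically_symmetric G x\<^sub>0"
    and associated: "associated_subgroup G x\<^sub>0 \<Gamma>"
begin

abbreviation "layer \<equiv> gsphere G x\<^sub>0"

definition sphere_mass :: "nat \<Rightarrow> real" where
  "sphere_mass r = vertex_weight G (layer r)"

definition ball_mass :: "nat \<Rightarrow> real" where
  "ball_mass r = (\<Sum>i\<le>r. sphere_mass i)"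

definition weight_between :: "'a set \<Rightarrow> 'a set \<Rightarrow> real" where
  "weight_between X Y = (\<Sum>x\<in>X. \<Sum>y\<in>Y. eweight G x y)"

definition shell_weight :: "nat \<Rightarrow> real" where
  "shell_weight r = weight_between (layer r) (layer (Suc r))"

lemma centre: "x\<^sub>0 \<in> verts G"
  using symmetric by (simp add: spherically_symmetric_def)

lemma sphere_verts: "layer r \<subseteq> verts G"
  by (auto simp: gsphere_def)

lemma finite_sphere: "finite (layer r)"
  using associated by (simp add: associated_subgroup_def)

lemma sphere_unique: "x \<in> layer r \<Longrightarrow> x \<in> layer s \<Longrightarrow> r = s"
  by (simp add: gsphere_def)

lemma sphere_0: "layer 0 = {x\<^sub>0}"
  using centre by (auto simp: gsphere_def zero_enat_def[symmetric] gdist_eq_enat_iff simp flip: enat_0)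

lemma identity_in_subgroup: "(\<lambda>x\<in>verts G. x) \<in> \<Gamma>"
  using associated subgroup.one_closed
  by (fastforce simp: associated_subgroup_def wgraph_AutoGroup_def BijGroup_def)

lemma vertex_orbit_eq: "vertex_orbit G \<Gamma> x = (\<lambda>g. g x) ` \<Gamma>"
  by (auto simp: vertex_orbit_def orbit_def)

lemma range_sphere: "range layer = vertex_orbit G \<Gamma> ` verts G"
  using associated by (auto simp: associated_subgroup_def vertex_orbits_def vertex_orbit_def orbits_def
      setcompr_eq_image)

lemma self_in_orbit: "x \<in> verts G \<Longrightarrow> x \<in> vertex_orbit G \<Gamma> x"
  unfolding vertex_orbit_eq by (rule image_eqI[OF _ identity_in_subgroup]) simp

lemma orbit_centre: "vertex_orbit G \<Gamma> x\<^sub>0 = layer 0"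
  using associated self_in_orbit[OF centre]
  by (auto simp: vertex_orbit_eq sphere_0 associated_subgroup_def)

lemma sphere_nonempty: "layer r \<noteq> {}"
proof -
  have "layer r \<in> vertex_orbit G \<Gamma> ` verts G" using range_sphere by blast
  then show ?thesis using self_in_orbit by auto
qed

text \<open>Every vertex lies in its own orbit and every orbit is a sphere; this is where the connectedness
  of the graph comes from.\<close>

lemma spheres_cover: "x \<in> verts G \<Longrightarrow> \<exists>r. x \<in> layer r"
  using self_in_orbit range_sphere by (metis imageE imageI)

lemma inj_sphere: "inj layer"
  using sphere_nonempty sphere_unique by (metis ex_in_conv injI)

lemma sphere_edge:
  assumes "(x, y) \<in> edges G" "x \<in> layer r" "y \<in> layer s"
  shows "r \<le> Suc s" "s \<le> Suc r"
proof -
  have "(y, x\<^sub>0) \<in> edges G ^^ s" "(x, x\<^sub>0) \<in> edges G ^^ r"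
    using assms by (auto simp: gsphere_def gdist_eq_enat_iff)
  then have "(x, x\<^sub>0) \<in> edges G ^^ Suc s" "(y, x\<^sub>0) \<in> edges G ^^ Suc r"
    using relpow_Suc_I2[OF assms(1)] relpow_Suc_I2[OF symD[OF edges_sym assms(1)]] by blast+
  then show "r \<le> Suc s" "s \<le> Suc r"
    using assms by (auto simp: gsphere_def gdist_eq_enat_iff simp del: relpow.simps)
qed

lemma sphere_predecessor:
  assumes x: "x \<in> layer (Suc r)"
  obtains y where "y \<in> layer r" "(x, y) \<in> edges G"
proof -
  have "(x, x\<^sub>0) \<in> edges G ^^ Suc r"
    using x by (auto simp: gsphere_def gdist_eq_enat_iff simp del: relpow.simps)
  then obtain y where y: "(x, y) \<in> edges G" "(y, x\<^sub>0) \<in> edges G ^^ r"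
    by (meson relpow_Suc_D2)
  have "y \<in> verts G" using y(1) edges_verts by auto
  then obtain s where s: "y \<in> layer s" using spheres_cover by blast
  then have "s \<le> r" using y(2) by (auto simp: gsphere_def gdist_eq_enat_iff)
  then have "s = r" using sphere_edge(1)[OF y(1) x s] by simp
  then show ?thesis using that s y(1) by blast
qed

lemma sphere_mass_pos: "0 < sphere_mass r"
  unfolding sphere_mass_def by (intro vertex_weight_pos finite_sphere sphere_nonempty sphere_verts)

lemma between_nonneg: "X \<subseteq> verts G \<Longrightarrow> Y \<subseteq> verts G \<Longrightarrow> 0 \<le> weight_between X Y"
  unfolding weight_between_def by (intro sum_nonneg) (auto intro: eweight_nonneg)

lemma shell_nonneg: "0 \<le> shell_weight r"
  unfolding shell_weight_def by (intro between_nonneg sphere_verts)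

lemma between_split:
  "finite Y \<Longrightarrow> weight_between X Y = weight_between X (Y \<inter> U) + weight_between X (Y - U)"
  unfolding weight_between_def sum.distrib[symmetric]
  by (intro sum.cong refl) (simp add: sum.Int_Diff)

lemma ball_mass_pos: "0 < ball_mass r"
  unfolding ball_mass_def by (intro sum_pos sphere_mass_pos) auto

lemma strict_mono_ball_mass: "strict_mono ball_mass"
  by (rule strict_mono_Suc_iff[THEN iffD2]) (simp add: ball_mass_def sphere_mass_pos)

lemma sum_sphere_mass: "p \<le> q \<Longrightarrow> (\<Sum>i\<in>{p<..q}. sphere_mass i) = ball_mass q - ball_mass p"
proof -
  assume "p \<le> q"
  then have "{..q} = {..p} \<union> {p<..q}" by auto
  then show ?thesis unfolding ball_mass_def
    using sum.union_disjoint[of "{..p}" "{p<..q}" sphere_mass] by (simp add: ivl_disj_int)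
qed

lemma vweight_const_on_sphere:
  "\<lbrakk>x \<in> layer r; x' \<in> layer r\<rbrakk> \<Longrightarrow> vweight G x = vweight G x'"
proof -
  assume "x \<in> layer r" "x' \<in> layer r"
  then obtain g where "g \<in> wgraph_auto G" "g x = x'"
    using symmetric unfolding spherically_symmetric_def by blast
  then show ?thesis using \<open>x \<in> layer r\<close> sphere_verts[of r]
    by (auto simp: wgraph_auto_def)
qed

text \<open>An automorphism fixing the centre preserves the distance to it and so permutes every sphere;
  hence the weight of the edges into a
  given sphere is the same from all vertices of another one.\<close>

lemma degree_const_on_sphere:
  assumes x: "x \<in> layer r" "x' \<in> layer r"
  shows "(\<Sum>y\<in>layer s. eweight G x y) = (\<Sum>y\<in>layer s. eweight G x' y)"
proof -
  obtain g where g: "g \<in> wgraph_auto G" "g x\<^sub>0 = x\<^sub>0" "g x = x'"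
    using symmetric x unfolding spherically_symmetric_def by blast
  have bij: "bij_betw g (verts G) (verts G)" using g by (auto simp: wgraph_auto_def Bij_def)
  have "g ` layer s \<subseteq> layer s"
    using auto_gdist[OF g(1) _ centre] g(2) bij by (auto simp: gsphere_def bij_betw_def)
  moreover have "inj_on g (layer s)"
    using bij sphere_verts by (auto simp: bij_betw_def intro: inj_on_subset)
  ultimately have "bij_betw g (layer s) (layer s)"
    using endo_inj_surj[OF finite_sphere] by (simp add: bij_betw_def)
  then have "(\<Sum>y\<in>layer s. eweight G x' y) = (\<Sum>y\<in>layer s. eweight G x' (g y))"
    by (rule sum.reindex_bij_betw[symmetric])
  also have "\<dots> = (\<Sum>y\<in>layer s. eweight G x y)"
    using g x sphere_verts by (intro sum.cong refl) (auto simp: wgraph_auto_def subset_iff)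
  finally show ?thesis ..
qed

section \<open>Symmetrization\<close>

definition sphere_fraction :: "'a set \<Rightarrow> nat \<Rightarrow> real" where
  "sphere_fraction U r = card (U \<inter> layer r) / card (layer r)"

lemma sum_over_sphere_part:
  fixes f :: "'a \<Rightarrow> real"
  assumes "\<And>x x'. x \<in> layer r \<Longrightarrow> x' \<in> layer r \<Longrightarrow> f x = f x'"
  shows "sum f (U \<inter> layer r) = sphere_fraction U r * sum f (layer r)"
proof -
  obtain x where x: "x \<in> layer r" using sphere_nonempty by blast
  have "sum f A = card A * f x" if "A \<subseteq> layer r" for A
    using assms[OF _ x] that by (subst sum.cong[OF refl, of _ _ "\<lambda>_. f x"]) auto
  from this[of "U \<inter> layer r"] this[of "layer r"] show ?thesis
    using finite_sphere sphere_nonempty by (simp add: sphere_fraction_def card_eq_0_iff)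
qed

text \<open>The boundary edges of \<open>U\<close> between two consecutive spheres weigh at least the jump of the
  fraction of these spheres that \<open>U\<close> occupies: the edges inside \<open>U\<close> cancel in the difference,
  and the two kinds of boundary edges enter it with opposite signs.\<close>

lemma shell_boundary_ge:
  "shell_weight r * \<bar>sphere_fraction U r - sphere_fraction U (Suc r)\<bar> \<le>
     weight_between (U \<inter> layer r) (layer (Suc r) - U) + weight_between (U \<inter> layer (Suc r)) (layer r - U)"
proof -
  let ?X = "layer r" and ?Y = "layer (Suc r)"
  have sub: "A \<inter> ?X \<subseteq> verts G" "A \<inter> ?Y \<subseteq> verts G" "?X - A \<subseteq> verts G" "?Y - A \<subseteq> verts G" for A
    using sphere_verts by auto
  have "sphere_fraction U r * shell_weight r = weight_between (U \<inter> ?X) ?Y"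
    unfolding shell_weight_def weight_between_def
    by (rule sum_over_sphere_part[symmetric]) (rule degree_const_on_sphere)
  also have "\<dots> = weight_between (U \<inter> ?X) (?Y \<inter> U) + weight_between (U \<inter> ?X) (?Y - U)"
    by (rule between_split[OF finite_sphere])
  finally have up: "sphere_fraction U r * shell_weight r = \<dots>" .
  have "sphere_fraction U (Suc r) * shell_weight r = sphere_fraction U (Suc r) * weight_between ?Y ?X"
    unfolding shell_weight_def weight_between_def by (simp add: sum_between_sym[OF sphere_verts sphere_verts])
  also have "\<dots> = weight_between (U \<inter> ?Y) ?X"
    unfolding weight_between_def
    by (rule sum_over_sphere_part[symmetric]) (rule degree_const_on_sphere)
  also have "\<dots> = weight_between (U \<inter> ?Y) (?X \<inter> U) + weight_between (U \<inter> ?Y) (?X - U)"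
    by (rule between_split[OF finite_sphere])
  also have "weight_between (U \<inter> ?Y) (?X \<inter> U) = weight_between (U \<inter> ?X) (?Y \<inter> U)"
    unfolding weight_between_def using sum_between_sym[OF sub(2) sub(1)] by (simp add: Int_commute)
  finally have "shell_weight r * (sphere_fraction U r - sphere_fraction U (Suc r)) =
      weight_between (U \<inter> ?X) (?Y - U) - weight_between (U \<inter> ?Y) (?X - U)"
    using up by (simp add: algebra_simps)
  moreover have "shell_weight r * \<bar>sphere_fraction U r - sphere_fraction U (Suc r)\<bar> =
      \<bar>shell_weight r * (sphere_fraction U r - sphere_fraction U (Suc r))\<bar>"
    using shell_nonneg by (simp add: abs_mult)
  moreover have "0 \<le> weight_between (U \<inter> ?X) (?Y - U)" "0 \<le> weight_between (U \<inter> ?Y) (?X - U)"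
    by (intro between_nonneg sub)+
  ultimately show ?thesis by linarith
qed

text \<open>Edges inside a sphere may also lie in the boundary; discarding them is harmless for a lower
  bound, and symmetric sets have none.\<close>

lemma boundary_weight_ge_sphere_fraction:
  assumes U: "finite U" "U \<subseteq> verts G"
  shows "(\<Sum>r\<le>N. shell_weight r * \<bar>sphere_fraction U r - sphere_fraction U (Suc r)\<bar>) \<le> boundary_weight G U"
proof -
  define up where "up r = edges G \<inter> (U \<inter> layer r) \<times> (layer (Suc r) - U)" for r
  define down where "down r = edges G \<inter> (U \<inter> layer (Suc r)) \<times> (layer r - U)" for r
  define w where "w e = (case e of (x, y) \<Rightarrow> eweight G x y)" for e
  have fin: "finite (up r)" "finite (down r)" for r
    unfolding up_def down_def using finite_sphere U(1) by (auto intro: finite_subset)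
  have part: "sum w (up r \<union> down r) =
      weight_between (U \<inter> layer r) (layer (Suc r) - U) + weight_between (U \<inter> layer (Suc r)) (layer r - U)" for r
  proof -
    have "up r \<inter> down r = {}" unfolding up_def down_def by (auto dest: sphere_unique)
    then have "sum w (up r \<union> down r) = sum w (up r) + sum w (down r)"
      by (intro sum.union_disjoint fin)
    also have "sum w (up r) = weight_between (U \<inter> layer r) (layer (Suc r) - U)"
      unfolding w_def up_def weight_between_def using U finite_sphere sphere_verts
      by (intro sum_edges_between) auto
    also have "sum w (down r) = weight_between (U \<inter> layer (Suc r)) (layer r - U)"
      unfolding w_def down_def weight_between_def using U finite_sphere sphere_verts
      by (intro sum_edges_between) auto
    finally show ?thesis .
  qed
  have "(\<Sum>r\<le>N. shell_weight r * \<bar>sphere_fraction U r - sphere_fraction U (Suc r)\<bar>) \<le>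
      (\<Sum>r\<le>N. sum w (up r \<union> down r))"
    unfolding part by (intro sum_mono shell_boundary_ge)
  also have "\<dots> = sum w (\<Union>r\<le>N. up r \<union> down r)"
    using fin by (intro sum.UNION_disjoint[symmetric])
      (auto simp: up_def down_def dest: sphere_unique)
  also have "\<dots> \<le> sum w (edge_boundary G U)"
    using finite_edge_boundary[OF U] eweight_pos
    by (intro sum_mono2) (auto simp: up_def down_def edge_boundary_def w_def intro: less_imp_le)
  finally show ?thesis by (simp add: boundary_weight_def w_def)
qed

lemma finite_subset_spheres:
  assumes "finite U" "U \<subseteq> verts G"
  obtains N where "U \<subseteq> (\<Union>r\<le>N. layer r)"
proof -
  have "\<forall>x\<in>U. \<exists>r. x \<in> layer r" using assms spheres_cover by blast
  then obtain \<rho> where \<rho>: "\<And>x. x \<in> U \<Longrightarrow> x \<in> layer (\<rho> x)" by metis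
  have "U \<subseteq> (\<Union>r\<le>Max (\<rho> ` U). layer r)"
    using \<rho> assms(1) by (auto intro!: bexI[of _ "\<rho> _"] Max_ge)
  then show ?thesis by (rule that)
qed

lemma vertex_weight_eq_sphere_fraction:
  assumes "U \<subseteq> (\<Union>r\<le>N. layer r)"
  shows "vertex_weight G U = (\<Sum>r\<le>N. sphere_mass r * sphere_fraction U r)"
proof -
  have "U = (\<Union>r\<le>N. U \<inter> layer r)" using assms by auto
  then have "vertex_weight G U = (\<Sum>r\<le>N. vertex_weight G (U \<inter> layer r))"
    unfolding vertex_weight_def using finite_sphere
    by (subst sum.UNION_disjoint[symmetric]) (auto dest: sphere_unique)
  also have "\<dots> = (\<Sum>r\<le>N. sphere_mass r * sphere_fraction U r)"
    unfolding vertex_weight_def sphere_mass_def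
    using sum_over_sphere_part[OF vweight_const_on_sphere] by (simp add: mult.commute)
  finally show ?thesis .
qed

text \<open>The capacity condition is only required where \<open>U\<close> meets one of the two spheres, since
  \<^const>\<open>sphere_fraction\<close> does not jump elsewhere.  For a set outside a ball this leaves
  only large radii, where annuli control the capacities.\<close>

lemma boundary_ratio_ge_flow:
  assumes U: "finite U" "U \<noteq> {}" "U \<subseteq> (\<Union>r\<le>N. layer r)" and K: "x\<^sub>0 \<in> U \<Longrightarrow> K = 0"
    and cap: "\<And>r. r \<le> N \<Longrightarrow> U \<inter> (layer r \<union> layer (Suc r)) \<noteq> {} \<Longrightarrow> \<bar>c * ball_mass r - K\<bar> \<le> shell_weight r"
  shows "c \<le> boundary_ratio G U"
proof -
  have Uv: "U \<subseteq> verts G" using U(3) sphere_verts by blast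
  have zero: "sphere_fraction U r = 0" if "U \<inter> layer r = {}" for r
    using that by (simp add: sphere_fraction_def)
  have "c * vertex_weight G U = c * (\<Sum>r\<le>N. sphere_mass r * sphere_fraction U r)"
    by (simp add: vertex_weight_eq_sphere_fraction[OF U(3)])
  also have "\<dots> \<le> (\<Sum>r\<le>N. shell_weight r * \<bar>sphere_fraction U r - sphere_fraction U (Suc r)\<bar>)"
  proof (rule flow_isoperimetric)
    show "sphere_fraction U (Suc N) = 0"
      using U(3) by (intro zero) (fastforce dest: sphere_unique)
    show "K * sphere_fraction U 0 = 0"
      using K zero[of 0] by (cases "x\<^sub>0 \<in> U") (auto simp: sphere_0)
    show "\<bar>c * sum sphere_mass {..r} - K\<bar> \<le> shell_weight r"
      if "r \<le> N" "sphere_fraction U r \<noteq> sphere_fraction U (Suc r)" for r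
      using cap[OF that(1)] zero[of r] zero[of "Suc r"] that(2)
      unfolding ball_mass_def by (metis Int_Un_distrib Un_empty)
  qed
  also have "\<dots> \<le> boundary_weight G U"
    using U(1) Uv by (rule boundary_weight_ge_sphere_fraction)
  finally show ?thesis
    using vertex_weight_pos[OF U(1,2) Uv] by (simp add: boundary_ratio_def le_divide_eq)
qed

lemma boundary_ratio_ge_balls:
  assumes U: "finite U" "U \<noteq> {}" "U \<subseteq> verts G"
    and c: "0 \<le> c" "\<And>r. c \<le> shell_weight r / ball_mass r"
  shows "c \<le> boundary_ratio G U"
proof -
  obtain N where N: "U \<subseteq> (\<Union>r\<le>N. layer r)" using finite_subset_spheres U by metis
  have "\<bar>c * ball_mass r - 0\<bar> \<le> shell_weight r" for r
    using c(1) c(2)[of r] ball_mass_pos[of r] by (simp add: le_divide_eq abs_mult)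
  then show ?thesis using boundary_ratio_ge_flow[OF U(1,2) N, of 0] by blast
qed

lemma boundary_ratio_ge_annuli:
  assumes U: "finite U" "U \<noteq> {}" "U \<subseteq> verts G - (\<Union>r\<le>a. layer r)"
    and c: "0 \<le> c" "\<And>p q. a \<le> p \<Longrightarrow> p < q \<Longrightarrow> c \<le> (shell_weight p + shell_weight q) / (ball_mass q - ball_mass p)"
  shows "c \<le> boundary_ratio G U"
proof -
  obtain N0 where N0: "U \<subseteq> (\<Union>r\<le>N0. layer r)" using finite_subset_spheres[of U] U by blast
  define N where "N = max a N0"
  have N: "U \<subseteq> (\<Union>r\<le>N. layer r)" "a \<le> N" using N0 unfolding N_def by fastforce+
  have "c * (ball_mass q - ball_mass p) \<le> shell_weight p + shell_weight q" if "a \<le> p" "p < q" for p q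
    using c(2)[OF that] strict_monoD[OF strict_mono_ball_mass that(2)] by (simp add: le_divide_eq)
  with N(2) c(1) shell_nonneg strict_mono_mono[OF strict_mono_ball_mass]
  obtain K where K: "\<And>r. r \<in> {a..N} \<Longrightarrow> \<bar>c * ball_mass r - K\<bar> \<le> shell_weight r"
    using flow_offset_exists[of a N c shell_weight ball_mass] by blast
  show ?thesis
  proof (rule boundary_ratio_ge_flow[OF U(1,2) N(1)])
    show "x\<^sub>0 \<in> U \<Longrightarrow> K = 0" using U(3) sphere_0 by auto
    fix r assume r: "r \<le> N" "U \<inter> (layer r \<union> layer (Suc r)) \<noteq> {}"
    have "a \<le> r"
    proof (rule ccontr)
      assume "\<not> a \<le> r"
      then have "r \<in> {..a}" "Suc r \<in> {..a}" by auto
      then have "layer r \<union> layer (Suc r) \<subseteq> (\<Union>r\<le>a. layer r)" by blast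
      then show False using r(2) U(3) by blast
    qed
    then show "\<bar>c * ball_mass r - K\<bar> \<le> shell_weight r" using K r(1) by simp
  qed
qed

section \<open>Balls and annuli\<close>

lemma finite_layers: "finite I \<Longrightarrow> finite (\<Union>i\<in>I. layer i)"
  using finite_sphere by simp

lemma vertex_weight_layers:
  "finite I \<Longrightarrow> vertex_weight G (\<Union>i\<in>I. layer i) = (\<Sum>i\<in>I. sphere_mass i)"
  unfolding vertex_weight_def sphere_mass_def using finite_sphere
  by (intro sum.UNION_disjoint) (auto dest: sphere_unique)

lemma between_layer_pred: "weight_between (layer (Suc r)) (layer r) = shell_weight r"
  unfolding shell_weight_def weight_between_def by (rule sum_between_sym[OF sphere_verts sphere_verts])

lemma layer_edge_cases:
  assumes "(x, y) \<in> edges G" "x \<in> layer i"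
  obtains j where "y \<in> layer j" "i \<le> Suc j" "j \<le> Suc i"
  using assms edges_verts spheres_cover sphere_edge by (metis SigmaD2 subsetD)

lemma edge_boundary_ball:
  "edge_boundary G (\<Union>i\<in>{..r}. layer i) = edges G \<inter> layer r \<times> layer (Suc r)"
proof (intro subset_antisym subrelI)
  fix x y assume "(x, y) \<in> edge_boundary G (\<Union>i\<in>{..r}. layer i)"
  then obtain i where i: "(x, y) \<in> edges G" "x \<in> layer i" "i \<le> r" "y \<notin> (\<Union>i\<in>{..r}. layer i)"
    by (auto simp: edge_boundary_def)
  obtain j where j: "y \<in> layer j" "i \<le> Suc j" "j \<le> Suc i"
    using layer_edge_cases[OF i(1,2)] .
  have "\<not> j \<le> r" using i(4) j(1) by auto
  then have "i = r" "j = Suc r" using j i(3) by auto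
  then show "(x, y) \<in> edges G \<inter> layer r \<times> layer (Suc r)" using i(1,2) j(1) by simp
next
  fix x y assume "(x, y) \<in> edges G \<inter> layer r \<times> layer (Suc r)"
  then show "(x, y) \<in> edge_boundary G (\<Union>i\<in>{..r}. layer i)"
    by (fastforce simp: edge_boundary_def dest: sphere_unique)
qed

lemma edge_boundary_annulus:
  assumes "p < q"
  shows "edge_boundary G (\<Union>i\<in>{p<..q}. layer i) =
    edges G \<inter> layer (Suc p) \<times> layer p \<union> edges G \<inter> layer q \<times> layer (Suc q)"
    (is "?L = ?R")
proof (intro subset_antisym subrelI)
  fix x y assume "(x, y) \<in> ?L"
  then obtain i where i: "(x, y) \<in> edges G" "x \<in> layer i" "p < i" "i \<le> q" "y \<notin> (\<Union>i\<in>{p<..q}. layer i)"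
    by (auto simp: edge_boundary_def)
  obtain j where j: "y \<in> layer j" "i \<le> Suc j" "j \<le> Suc i"
    using layer_edge_cases[OF i(1,2)] .
  have "\<not> (p < j \<and> j \<le> q)" using i(5) j(1) by auto
  then have "i = Suc p \<and> j = p \<or> i = q \<and> j = Suc q" using j i(3,4) by linarith
  then show "(x, y) \<in> ?R" using i(1,2) j(1) by auto
next
  fix x y assume "(x, y) \<in> ?R"
  then obtain i j where "(x, y) \<in> edges G" "x \<in> layer i" "y \<in> layer j"
    "i \<in> {p<..q}" "j \<notin> {p<..q}"
    using assms by fastforce
  then show "(x, y) \<in> ?L"
    unfolding edge_boundary_def using sphere_unique by blast
qed

lemma boundary_ratio_ball:
  "boundary_ratio G (\<Union>i\<in>{..r}. layer i) = shell_weight r / ball_mass r"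
  using sum_edges_between[OF finite_sphere finite_sphere sphere_verts sphere_verts]
  by (simp add: boundary_ratio_def vertex_weight_layers ball_mass_def boundary_weight_def
      edge_boundary_ball shell_weight_def weight_between_def del: UN_simps)

lemma boundary_ratio_annulus:
  assumes "p < q"
  shows "boundary_ratio G (\<Union>i\<in>{p<..q}. layer i) = (shell_weight p + shell_weight q) / (ball_mass q - ball_mass p)"
proof -
  let ?in = "edges G \<inter> layer (Suc p) \<times> layer p" and ?out = "edges G \<inter> layer q \<times> layer (Suc q)"
  have "?in \<inter> ?out = {}" using assms by (auto dest: sphere_unique)
  then have "boundary_weight G (\<Union>i\<in>{p<..q}. layer i) =
      (\<Sum>(x, y)\<in>?in. eweight G x y) + (\<Sum>(x, y)\<in>?out. eweight G x y)"
    unfolding boundary_weight_def edge_boundary_annulus[OF assms]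
    using finite_sphere by (intro sum.union_disjoint) auto
  also have "\<dots> = weight_between (layer (Suc p)) (layer p) + shell_weight q"
    unfolding shell_weight_def weight_between_def by (simp only: sum_edges_between finite_sphere sphere_verts)
  finally show ?thesis
    using assms by (simp only: boundary_ratio_def between_layer_pred vertex_weight_layers
        sum_sphere_mass finite_greaterThanAtMost less_imp_le)
qed

lemma exhaustion_balls: "exhaustion G (\<lambda>i. \<Union>r\<in>{..i}. layer r)"
  unfolding exhaustion_def
proof (intro conjI allI)
  show "(\<Union>r\<in>{..i}. layer r) \<subseteq> (\<Union>r\<in>{..Suc i}. layer r)" for i
    by (rule UN_mono) auto
  show "(\<Union>i. \<Union>r\<in>{..i}. layer r) = verts G"
  proof (intro subset_antisym subsetI)
    fix x assume "x \<in> verts G"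
    then obtain r where "x \<in> layer r" using spheres_cover by blast
    then show "x \<in> (\<Union>i. \<Union>r\<in>{..i}. layer r)" by blast
  qed (auto simp: gsphere_def)
qed (rule finite_layers, simp)

text \<open>An infimum of nonnegative real ratios is itself a real number, to which the real-valued
  isoperimetric inequalities apply.\<close>

lemma nonneg_ereal_below_real:
  assumes "0 \<le> (e :: ereal)" "e \<le> ereal y"
  obtains c where "0 \<le> c" "e = ereal c"
  using assms by (cases e) auto

lemma cheeger_eq_INF_balls: "cheeger G = (INF r. ereal (shell_weight r / ball_mass r))"
proof -
  let ?I = "INF r. ereal (shell_weight r / ball_mass r)"
  have "outer_cheeger G {} = ?I"
  proof (rule antisym)
    show "outer_cheeger G {} \<le> ?I"
    proof (rule INF_greatest)
      fix r
      show "outer_cheeger G {} \<le> ereal (shell_weight r / ball_mass r)"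
        unfolding boundary_ratio_ball[symmetric]
        using sphere_nonempty sphere_verts finite_sphere by (intro outer_cheeger_lower) auto
    qed
    have nonneg: "0 \<le> ?I" by (intro INF_greatest) (simp add: shell_nonneg less_imp_le[OF ball_mass_pos])
    have low: "?I \<le> ereal (shell_weight r / ball_mass r)" for r by (rule INF_lower) simp
    obtain c where c: "0 \<le> c" "?I = ereal c"
      by (rule nonneg_ereal_below_real[OF nonneg low])
    have "c \<le> shell_weight r / ball_mass r" for r using low[of r] unfolding c by simp
    then show "?I \<le> outer_cheeger G {}"
      unfolding c(2) outer_cheeger_def
      using boundary_ratio_ge_balls c(1) by (intro INF_greatest) auto
  qed
  then show ?thesis using cheeger_eq_outer_cheeger[OF infinite_verts exhaustion_balls] by simp
qed

lemma outer_cheeger_ball_eq_INF_annuli: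
  "outer_cheeger G (\<Union>r\<in>{..a}. layer r) =
    (INF p\<in>{a..}. INF q\<in>{p + 1..}. ereal ((shell_weight p + shell_weight q) / (ball_mass q - ball_mass p)))"
    (is "_ = ?I")
proof (rule antisym)
  show "outer_cheeger G (\<Union>r\<in>{..a}. layer r) \<le> ?I"
  proof (intro INF_greatest)
    fix p q assume pq: "p \<in> {a..}" "q \<in> {p + 1..}"
    then have ratio: "boundary_ratio G (\<Union>i\<in>{p<..q}. layer i) = (shell_weight p + shell_weight q) / (ball_mass q - ball_mass p)"
      by (intro boundary_ratio_annulus) simp
    have "(\<Union>i\<in>{p<..q}. layer i) \<noteq> {}" using sphere_nonempty pq by auto
    moreover have "(\<Union>i\<in>{p<..q}. layer i) \<subseteq> verts G - (\<Union>r\<in>{..a}. layer r)"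
      using sphere_verts pq by (fastforce dest: sphere_unique)
    ultimately show "outer_cheeger G (\<Union>r\<in>{..a}. layer r) \<le>
        ereal ((shell_weight p + shell_weight q) / (ball_mass q - ball_mass p))"
      unfolding ratio[symmetric] by (intro outer_cheeger_lower finite_layers) auto
  qed
  have mass: "ball_mass p < ball_mass q" if "p < q" for p q
    using that strict_mono_ball_mass by (simp add: strict_mono_def)
  have nonneg: "0 \<le> ?I"
  proof (intro INF_greatest)
    fix p q assume "p \<in> {a..}" "q \<in> {p + 1..}"
    then show "0 \<le> ereal ((shell_weight p + shell_weight q) / (ball_mass q - ball_mass p))"
      using mass[of p q] shell_nonneg[of p] shell_nonneg[of q] by simp
  qed
  have low: "?I \<le> ereal ((shell_weight p + shell_weight q) / (ball_mass q - ball_mass p))"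
    if "a \<le> p" "p < q" for p q
  proof (rule INF_lower2[of p])
    show "(INF q\<in>{p + 1..}. ereal ((shell_weight p + shell_weight q) / (ball_mass q - ball_mass p))) \<le>
        ereal ((shell_weight p + shell_weight q) / (ball_mass q - ball_mass p))"
      using that by (intro INF_lower) simp
  qed (use that in simp)
  obtain c where c: "0 \<le> c" "?I = ereal c"
    using nonneg_ereal_below_real[OF nonneg low[of a "Suc a"]] by auto
  have "c \<le> (shell_weight p + shell_weight q) / (ball_mass q - ball_mass p)" if "a \<le> p" "p < q" for p q
    using low[OF that] unfolding c by simp
  then show "?I \<le> outer_cheeger G (\<Union>r\<in>{..a}. layer r)"
    unfolding c(2) outer_cheeger_def
    using boundary_ratio_ge_annuli[of _ a] c(1) by (intro INF_greatest) auto
qed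

lemma cheeger_infinity_eq_liminf_annuli:
  "cheeger_infinity G =
    liminf (\<lambda>p. INF q\<in>{p + 1..}. ereal ((shell_weight p + shell_weight q) / (ball_mass q - ball_mass p)))"
  by (simp only: cheeger_infinity_eq_SUP_outer_cheeger[OF infinite_verts exhaustion_balls]
      outer_cheeger_ball_eq_INF_annuli liminf_SUP_INF)

lemma ball_mass_at_top:
  assumes "(\<Sum>\<^sub>\<infinity>x\<in>verts G. ennreal (vweight G x)) = \<infinity>"
  shows "filterlim ball_mass at_top sequentially"
  unfolding filterlim_at_top
proof
  fix Z :: real
  have "\<exists>N. Z \<le> ball_mass N"
  proof (rule ccontr)
    assume "\<nexists>N. Z \<le> ball_mass N"
    then have Z: "ball_mass N \<le> Z" for N by (meson linear)
    have "(\<Sum>\<^sub>\<infinity>x\<in>verts G. ennreal (vweight G x)) \<le> ennreal Z"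
    proof (subst nonneg_infsum_complete)
      show "(SUP F\<in>{F. finite F \<and> F \<subseteq> verts G}. \<Sum>x\<in>F. ennreal (vweight G x)) \<le> ennreal Z"
      proof (rule SUP_least, clarify)
        fix F assume F: "finite F" "F \<subseteq> verts G"
        then obtain N where N: "F \<subseteq> (\<Union>r\<le>N. layer r)" by (rule finite_subset_spheres)
        have "(\<Sum>x\<in>F. ennreal (vweight G x)) = ennreal (sum (vweight G) F)"
          using F vweight_pos by (intro sum_ennreal) (auto intro: less_imp_le)
        also have "sum (vweight G) F \<le> vertex_weight G (\<Union>r\<le>N. layer r)"
          unfolding vertex_weight_def using N vweight_pos sphere_verts finite_layers
          by (intro sum_mono2) (blast intro: less_imp_le)+
        also have "\<dots> = ball_mass N" by (simp add: vertex_weight_layers ball_mass_def)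
        also have "\<dots> \<le> Z" by (rule Z)
        finally show "(\<Sum>x\<in>F. ennreal (vweight G x)) \<le> ennreal Z"
          by (simp add: ennreal_leI)
      qed
    qed simp
    then show False using assms by (simp add: top_unique)
  qed
  then obtain N where "Z \<le> ball_mass N" ..
  then have "Z \<le> ball_mass n" if "n \<ge> N" for n
    using strict_mono_mono[OF strict_mono_ball_mass] that by (meson monoD order_trans)
  then show "eventually (\<lambda>n. Z \<le> ball_mass n) sequentially"
    unfolding eventually_sequentially by blast
qed

section \<open>The quotient is a weighted half-line\<close>

abbreviation "Q \<equiv> quotient_graph G \<Gamma>"

lemma verts_quotient: "verts Q = range layer"
  using associated by (simp add: quotient_graph_def associated_subgroup_def)

lemma layer_eq_iff: "layer i = layer j \<longleftrightarrow> i = j"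
  using inj_sphere by (simp add: inj_eq)

text \<open>Consecutive spheres are adjacent because every vertex off the centre has a neighbour one step
  closer to it; other spheres are not, because distances of neighbours differ by at most one.\<close>

lemma edges_quotient: "edges Q = {(layer i, layer j) |i j. j = Suc i \<or> i = Suc j}"
proof (intro subset_antisym subrelI)
  fix X Y assume "(X, Y) \<in> edges Q"
  moreover have "vertex_orbits G \<Gamma> = range layer"
    using associated by (simp add: associated_subgroup_def)
  ultimately obtain i j x y where ij: "X = layer i" "Y = layer j" "i \<noteq> j"
    "x \<in> layer i" "y \<in> layer j" "(x, y) \<in> edges G"
    by (auto simp: quotient_graph_def layer_eq_iff)
  then have "i \<noteq> j" "i \<le> Suc j" "j \<le> Suc i" using sphere_edge[OF ij(6,4,5)] by auto
  then have "j = Suc i \<or> i = Suc j" by linarith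
  then show "(X, Y) \<in> {(layer i, layer j) |i j. j = Suc i \<or> i = Suc j}"
    using ij(1,2) by blast
next
  have adj: "\<exists>x\<in>layer (Suc i). \<exists>y\<in>layer i. (x, y) \<in> edges G" for i
    using sphere_nonempty[of "Suc i"] sphere_predecessor by (metis ex_in_conv)
  have adj': "\<exists>x\<in>layer i. \<exists>y\<in>layer (Suc i). (x, y) \<in> edges G" for i
    using adj[of i] edges_sym by (meson symD)
  fix X Y assume "(X, Y) \<in> {(layer i, layer j) |i j. j = Suc i \<or> i = Suc j}"
  then obtain i j where "X = layer i" "Y = layer j" "j = Suc i \<or> i = Suc j" by blast
  then show "(X, Y) \<in> edges Q"
    using associated adj[of i] adj[of j] adj'[of i] adj'[of j]
    by (auto simp: quotient_graph_def associated_subgroup_def layer_eq_iff)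
qed

lemma gdist_quotient: "gdist Q (layer i) (layer 0) = enat i"
  unfolding gdist_eq_enat_iff
proof (intro conjI allI impI)
  show "(layer i, layer 0) \<in> edges Q ^^ i"
  proof (induction i)
    case (Suc i)
    have "(layer (Suc i), layer i) \<in> edges Q" unfolding edges_quotient by blast
    then show ?case using Suc by (rule relpow_Suc_I2)
  qed simp
  fix n assume "(layer i, layer 0) \<in> edges Q ^^ n"
  then show "i \<le> n"
  proof (induction n arbitrary: i)
    case 0
    then show ?case by (simp add: layer_eq_iff)
  next
    case (Suc n)
    then obtain Z where Z: "(layer i, Z) \<in> edges Q" "(Z, layer 0) \<in> edges Q ^^ n"
      by (meson relpow_Suc_D2)
    then obtain j where "Z = layer j" "j = Suc i \<or> i = Suc j"
      unfolding edges_quotient by (auto simp: layer_eq_iff)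
    then show ?case using Suc.IH[of j] Z(2) by auto
  qed
qed

lemma gball_quotient: "gball Q (vertex_orbit G \<Gamma> x\<^sub>0) r = layer ` {..r}"
  by (auto simp: gball_def verts_quotient orbit_centre gdist_quotient)

lemma vertex_weight_quotient: "vertex_weight Q (layer ` I) = (\<Sum>i\<in>I. sphere_mass i)"
  unfolding vertex_weight_def sphere_mass_def
  using inj_sphere by (subst sum.reindex) (auto simp: quotient_graph_def inj_on_def)

lemma eweight_quotient: "i \<noteq> j \<Longrightarrow> eweight Q (layer i) (layer j) = weight_between (layer i) (layer j)"
  by (simp add: quotient_graph_def layer_eq_iff weight_between_def)

lemma edge_boundary_quotient:
  "edge_boundary Q (layer ` I) =
    {(layer i, layer j) |i j. (j = Suc i \<or> i = Suc j) \<and> i \<in> I \<and> j \<notin> I}"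
  by (auto simp: edge_boundary_def edges_quotient layer_eq_iff image_iff)

lemma boundary_ratio_quotient_ball:
  "boundary_ratio Q (layer ` {..r}) = shell_weight r / ball_mass r"
proof -
  have "edge_boundary Q (layer ` {..r}) = {(layer r, layer (Suc r))}"
  proof -
    have "(j = Suc i \<or> i = Suc j) \<and> i \<in> {..r} \<and> j \<notin> {..r} \<longleftrightarrow> i = r \<and> j = Suc r" for i j
      by auto
    then show ?thesis unfolding edge_boundary_quotient by simp
  qed
  then show ?thesis
    by (simp add: boundary_ratio_def boundary_weight_def vertex_weight_quotient ball_mass_def
        eweight_quotient shell_weight_def)
qed

lemma boundary_ratio_quotient_annulus:
  assumes "p < q"
  shows "boundary_ratio Q (layer ` {p<..q}) = (shell_weight p + shell_weight q) / (ball_mass q - ball_mass p)"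
proof -
  have "edge_boundary Q (layer ` {p<..q}) = {(layer (Suc p), layer p), (layer q, layer (Suc q))}"
  proof -
    have "(j = Suc i \<or> i = Suc j) \<and> i \<in> {p<..q} \<and> j \<notin> {p<..q} \<longleftrightarrow>
        i = Suc p \<and> j = p \<or> i = q \<and> j = Suc q" for i j
      using assms by auto
    then show ?thesis unfolding edge_boundary_quotient by auto
  qed
  then show ?thesis
    using assms by (simp add: boundary_ratio_def boundary_weight_def vertex_weight_quotient
        sum_sphere_mass eweight_quotient between_layer_pred layer_eq_iff flip: shell_weight_def)
qed

end

theorem theorem1p4:
  fixes G :: "'a wgraph" and x\<^sub>0 :: 'a and \<Gamma> :: "('a \<Rightarrow> 'a) set"
    and B :: "nat \<Rightarrow> 'a set set" and A :: "nat \<Rightarrow> nat \<Rightarrow> 'a set set"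
  assumes "weighted_graph G"
    and "infinite (verts G)"
    and "spherically_symmetric G x\<^sub>0"
    and "associated_subgroup G x\<^sub>0 \<Gamma>"
  defines "B \<equiv> \<lambda>r. gball (quotient_graph G \<Gamma>) (vertex_orbit G \<Gamma> x\<^sub>0) r"
    and "A \<equiv> \<lambda>r R. B R - B r"
  shows "cheeger G = (INF r. ereal (boundary_ratio (quotient_graph G \<Gamma>) (B r))) \<and>
    cheeger_infinity G =
      liminf (\<lambda>r. INF R\<in>{r + 1..}. ereal (boundary_ratio (quotient_graph G \<Gamma>) (A r R))) \<and>
    ((\<Sum>\<^sub>\<infinity>x\<in>verts G. ennreal (vweight G x)) = \<infinity> \<longrightarrow>
      cheeger_infinity G =
        liminf (\<lambda>r. ereal (boundary_ratio (quotient_graph G \<Gamma>) (B r))))"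
proof -
  interpret symmetric_graph G x\<^sub>0 \<Gamma>
    using assms(1-4) by (simp add: symmetric_graph_def symmetric_graph_axioms_def)
  have B: "B r = layer ` {..r}" for r
    unfolding B_def by (rule gball_quotient)
  have A: "A r R = layer ` {r<..R}" for r R
  proof -
    have "A r R = layer ` ({..R} - {..r})"
      unfolding A_def B using inj_sphere by (simp add: image_set_diff)
    also have "{..R} - {..r} = {r<..R}" by auto
    finally show ?thesis .
  qed
  have annuli: "(INF R\<in>{r + 1..}. ereal (boundary_ratio Q (A r R))) =
      (INF R\<in>{r + 1..}. ereal ((shell_weight r + shell_weight R) / (ball_mass R - ball_mass r)))" for r
    unfolding A by (intro INF_cong refl) (simp add: boundary_ratio_quotient_annulus)
  show ?thesis
    unfolding annuli B boundary_ratio_quotient_ball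
  proof (intro conjI impI)
    show "cheeger G = (INF r. ereal (shell_weight r / ball_mass r))"
      by (rule cheeger_eq_INF_balls)
    show inf: "cheeger_infinity G =
        liminf (\<lambda>r. INF R\<in>{r + 1..}. ereal ((shell_weight r + shell_weight R) / (ball_mass R - ball_mass r)))"
      by (rule cheeger_infinity_eq_liminf_annuli)
    assume "(\<Sum>\<^sub>\<infinity>x\<in>verts G. ennreal (vweight G x)) = \<infinity>"
    then show "cheeger_infinity G = liminf (\<lambda>r. ereal (shell_weight r / ball_mass r))"
      unfolding inf
      by (intro liminf_segment_ratio_eq shell_nonneg ball_mass_pos strict_mono_ball_mass
          ball_mass_at_top)
  qed
qed

end
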